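(* Let $n\ge1$, let $S_+^n=\{x\in\mathbb{R}^{n+1}: x_1^2+x_2^2+\cdots+x_{n+1}^2=1,\ x_1>0\}$ be the open hemisphere with the geodesic metric $d$, let $A\subset S_+^n$ be a set of points (not necessarily finite), and let $\sigma=[a_0a_1\ldots a_p]$, $p\ge0$, be a simplex with vertices in $A$. Then: (1) $\sigma$ has a strong witness in $S_+^n$ with respect to $A$ if and only if every subsimplex $\tau\le\sigma$ has a weak witness in $S_+^n$ with respect to $A$. (2) If for every nonempty $I\subseteq\{a_0,\ldots,a_p\}$ a weak witness $x_I\in S_+^n$ with respect to $A$ is given for the subsimplex $\sigma_I$ with vertex set $I$, then the geodesic convex hull of the points $x_I$ contains a strong witness for $\sigma$ with respect to $A$.
   Context: The geodesic metric is $d(x,y)=\arccos\langle x,y\rangle$. A simplex $\sigma=[a_0\ldots a_p]$ with vertices in $A$ is a set of $p+1$ distinct points $\{a_0,\ldots,a_p\}\subseteq A$; a subsimplex $\tau\le\sigma$ is a simplex whose vertex set is a nonempty subset of that of $\sigma$ (including $\sigma$ itself). A point $x\in S_+^n$ is a weak witness for $\sigma$ with respect to $A$ if $d(x,a)\le d(x,b)$ whenever $a\in\{a_0,\ldots,a_p\}$ and $b\in A\setminus\{a_0,\ldots,a_p\}$. It is a strong witness for $\sigma$ with respect to $A$ if it is a weak witness and additionally $d(x,a_0)=d(x,a_1)=\cdots=d(x,a_p)$. A subset of $S_+^n$ is geodesically convex if it contains the unique geodesic (great circle) arc in $S_+^n$ between any two of its points; the geodesic convex hull of a set is the smallest geodesically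 convex subset containing it. *)

theory Defs
  imports "HOL-Analysis.Analysis"
begin

text \<open>
  The ambient space is \<open>real ^ 'm\<close>, and the index \<open>k\<close> names the coordinate that is required
  to be positive on the open hemisphere.
\<close>

definition hemisphere :: "'m::finite \<Rightarrow> (real ^ 'm) set" where
  "hemisphere k = {x. norm x = 1 \<and> 0 < x $ k}"

definition gdist :: "real ^ 'm::finite \<Rightarrow> real ^ 'm \<Rightarrow> real" where
  "gdist x y = arccos (x \<bullet> y)"

text \<open>A simplex is identified with its vertex set.\<close>

definition simplex_in :: "'a set \<Rightarrow> nat \<Rightarrow> 'a set \<Rightarrow> bool" where
  "simplex_in A p \<sigma> \<longleftrightarrow> \<sigma> \<subseteq> A \<and> finite \<sigma> \<and> card \<sigma> = p + 1"

definition subsimplices :: "'a set \<Rightarrow> 'a set set" where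
  "subsimplices \<sigma> = {\<tau>. \<tau> \<noteq> {} \<and> \<tau> \<subseteq> \<sigma>}"

definition weak_witness ::
  "'m::finite \<Rightarrow> (real ^ 'm) set \<Rightarrow> (real ^ 'm) set \<Rightarrow> real ^ 'm \<Rightarrow> bool" where
  "weak_witness k A \<sigma> x \<longleftrightarrow>
     x \<in> hemisphere k \<and> (\<forall>a\<in>\<sigma>. \<forall>b\<in>A - \<sigma>. gdist x a \<le> gdist x b)"

definition strong_witness ::
  "'m::finite \<Rightarrow> (real ^ 'm) set \<Rightarrow> (real ^ 'm) set \<Rightarrow> real ^ 'm \<Rightarrow> bool" where
  "strong_witness k A \<sigma> x \<longleftrightarrow>
     weak_witness k A \<sigma> x \<and> (\<forall>a\<in>\<sigma>. \<forall>a'\<in>\<sigma>. gdist x a = gdist x a')"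

text \<open>
  \<open>E\<close> is a great circle arc from \<open>x\<close> to \<open>y\<close> inside the hemisphere. The length \<open>\<theta>\<close> is not
  bounded explicitly: an arc that goes the long way round leaves the hemisphere. The lemma
  \<open>ex1_geodesic_arc\<close> below confirms that the arc exists and is unique.
\<close>

definition geodesic_arc ::
  "'m::finite \<Rightarrow> real ^ 'm \<Rightarrow> real ^ 'm \<Rightarrow> (real ^ 'm) set \<Rightarrow> bool" where
  "geodesic_arc k x y E \<longleftrightarrow>
     E \<subseteq> hemisphere k \<and>
     (\<exists>u \<theta>. norm u = 1 \<and> x \<bullet> u = 0 \<and> 0 \<le> \<theta> \<and>
        y = cos \<theta> *\<^sub>R x + sin \<theta> *\<^sub>R u \<and>
        E = (\<lambda>t. cos t *\<^sub>R x + sin t *\<^sub>R u) ` {0..\<theta>})"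

lemma norm_great_circle:
  fixes x u :: "'a::real_inner"
  assumes "norm x = 1" "norm u = 1" "x \<bullet> u = 0"
  shows "norm (cos t *\<^sub>R x + sin t *\<^sub>R u) = 1"
proof -
  have "x \<bullet> x = 1" "u \<bullet> u = 1" "u \<bullet> x = 0"
    using assms by (simp_all add: norm_eq_1 inner_commute)
  then have "(cos t *\<^sub>R x + sin t *\<^sub>R u) \<bullet> (cos t *\<^sub>R x + sin t *\<^sub>R u) = (cos t)\<^sup>2 + (sin t)\<^sup>2"
    using assms(3) by (simp add: inner_add_left inner_add_right power2_eq_square)
  then show ?thesis by (simp add: norm_eq_1)
qed

lemma ex1_geodesic_arc:
  fixes x y :: "real ^ 'm::finite"
  assumes dim: "CARD('m) \<ge> 2" and x: "x \<in> hemisphere k" and y: "y \<in> hemisphere k"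
  shows "\<exists>!E. geodesic_arc k x y E"
proof (rule ex_ex1I)
  have nx: "norm x = 1" "x \<bullet> x = 1" and xk: "0 < x $ k"
    and ny: "norm y = 1" "y \<bullet> y = 1" and yk: "0 < y $ k"
    using x y by (auto simp: hemisphere_def norm_eq_1)
  show "\<exists>E. geodesic_arc k x y E"
  proof (cases "y = x")
    case True
    have "2 \<le> DIM(real ^ 'm)" using dim by simp
    then obtain v where v: "v \<noteq> 0" "orthogonal x v"
      by (rule orthogonal_to_vector_exists)
    define u where "u = v /\<^sub>R norm v"
    have "norm u = 1" "x \<bullet> u = 0"
      using v by (simp_all add: u_def orthogonal_def)
    then have "geodesic_arc k x y {x}"
      unfolding geodesic_arc_def
      by (intro conjI exI[of _ u] exI[of _ "0::real"]) (use x True in auto)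
    then show ?thesis ..
  next
    case False
    define c where "c = x \<bullet> y"
    define w where "w = y - c *\<^sub>R x"
    define \<theta> where "\<theta> = arccos c"
    have c1: "\<bar>c\<bar> \<le> 1"
      using Cauchy_Schwarz_ineq2[of x y] nx ny by (simp add: c_def)
    have ww: "w \<bullet> w = 1 - c\<^sup>2"
      by (simp add: w_def inner_diff_left inner_diff_right nx ny c_def[symmetric]
          inner_commute[of y x] power2_eq_square algebra_simps)
    have w0: "w \<noteq> 0"
    proof
      assume "w = 0"
      then have yc: "y = c *\<^sub>R x" by (simp add: w_def)
      then have "\<bar>c\<bar> = 1" using nx ny by simp
      moreover have "c > 0"
        using yc xk yk by (simp add: zero_less_mult_iff)
      ultimately show False using yc False by simp
    qed
    define s where "s = norm w"
    have s: "s > 0" "s\<^sup>2 = 1 - c\<^sup>2"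
      using w0 ww by (simp_all add: s_def power2_norm_eq_inner)
    define u where "u = w /\<^sub>R s"
    have u: "norm u = 1" using w0 by (simp add: u_def s_def)
    have xu: "x \<bullet> u = 0"
      by (simp add: u_def w_def inner_diff_right nx c_def[symmetric])
    have ct: "cos \<theta> = c" using c1 by (simp add: \<theta>_def cos_arccos_abs)
    have st: "sin \<theta> = s"
    proof -
      have "sin \<theta> = sqrt (1 - c\<^sup>2)"
        using c1 by (simp add: \<theta>_def sin_arccos_abs)
      then show ?thesis using s by (metis abs_of_pos real_sqrt_abs)
    qed
    have yu: "y = cos \<theta> *\<^sub>R x + sin \<theta> *\<^sub>R u"
      using s by (simp add: ct st u_def w_def)
    have th: "0 \<le> \<theta>" "\<theta> \<le> pi"
      using c1 by (auto simp: \<theta>_def intro: arccos_lbound arccos_ubound)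
    have "\<theta> \<noteq> pi" using st s by auto
    then have thpi: "\<theta> < pi" using th by simp
    have pos: "0 < (cos t *\<^sub>R x + sin t *\<^sub>R u) $ k" if t: "0 \<le> t" "t \<le> \<theta>" for t
    proof -
      have "s * ((cos t *\<^sub>R x + sin t *\<^sub>R u) $ k) = sin (\<theta> - t) * x $ k + sin t * y $ k"
        using arg_cong[OF yu, of "\<lambda>v. v $ k"] by (simp add: sin_diff ct st algebra_simps)
      moreover have "0 < sin (\<theta> - t) * x $ k + sin t * y $ k"
      proof (cases "t = \<theta>")
        case True
        then show ?thesis using st s yk by simp
      next
        case False
        then have "0 < sin (\<theta> - t)" using t thpi by (intro sin_gt_zero) auto
        moreover have "0 \<le> sin t" using t thpi by (intro sin_ge_zero) auto
        ultimately show ?thesis using xk yk by (simp add: add_pos_nonneg)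
      qed
      ultimately show ?thesis using s(1) by (metis zero_less_mult_pos)
    qed
    have "(\<lambda>t. cos t *\<^sub>R x + sin t *\<^sub>R u) ` {0..\<theta>} \<subseteq> hemisphere k"
      using pos norm_great_circle[OF nx(1) u xu] by (auto simp: hemisphere_def)
    then show ?thesis
      unfolding geodesic_arc_def using u xu th yu by blast
  qed
next
  fix E E'
  assume "geodesic_arc k x y E" and "geodesic_arc k x y E'"
  then obtain u \<theta> u' \<theta>'
    where E: "E \<subseteq> hemisphere k" "x \<bullet> u = 0" "0 \<le> \<theta>"
        "y = cos \<theta> *\<^sub>R x + sin \<theta> *\<^sub>R u" "E = (\<lambda>t. cos t *\<^sub>R x + sin t *\<^sub>R u) ` {0..\<theta>}"
      and E': "E' \<subseteq> hemisphere k" "x \<bullet> u' = 0" "0 \<le> \<theta>'"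
        "y = cos \<theta>' *\<^sub>R x + sin \<theta>' *\<^sub>R u'" "E' = (\<lambda>t. cos t *\<^sub>R x + sin t *\<^sub>R u') ` {0..\<theta>'}"
    unfolding geodesic_arc_def by blast
  have nx: "x \<bullet> x = 1" and xk: "0 < x $ k"
    using x by (auto simp: hemisphere_def norm_eq_1)
  have short: "\<phi> < pi" if "(\<lambda>t. cos t *\<^sub>R x + sin t *\<^sub>R v) ` {0..\<phi>} \<subseteq> hemisphere k" for v \<phi>
  proof (rule ccontr)
    assume "\<not> \<phi> < pi"
    then have "cos pi *\<^sub>R x + sin pi *\<^sub>R v \<in> hemisphere k"
      using that by (meson atLeastAtMost_iff image_subset_iff not_less pi_ge_zero)
    then show False using xk by (simp add: hemisphere_def)
  qed
  have th: "\<theta> < pi" "\<theta>' < pi"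
    using short E(1,5) E'(1,5) by blast+
  have "x \<bullet> y = cos \<theta>" using E(2) by (subst E(4)) (simp add: inner_add_right nx)
  moreover have "x \<bullet> y = cos \<theta>'" using E'(2) by (subst E'(4)) (simp add: inner_add_right nx)
  ultimately have eq: "\<theta>' = \<theta>"
    using th E(3) E'(3) cos_inj_pi[of \<theta> \<theta>'] by simp
  show "E = E'"
  proof (cases "\<theta> = 0")
    case True
    then show ?thesis using E(5) E'(5) eq by simp
  next
    case False
    then have "sin \<theta> > 0" using E(3) th by (intro sin_gt_zero) auto
    moreover have "sin \<theta> *\<^sub>R u = sin \<theta> *\<^sub>R u'" using E(4) E'(4) eq by (metis add_left_imp_eq)
    ultimately have "u = u'" by simp
    then show ?thesis using E(5) E'(5) eq by simp
  qed
qed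

text \<open>The geodesic convex hull of \<open>X\<close> is \<open>geodesically_convex k hull X\<close>.\<close>

definition geodesically_convex :: "'m::finite \<Rightarrow> (real ^ 'm) set \<Rightarrow> bool" where
  "geodesically_convex k C \<longleftrightarrow>
     C \<subseteq> hemisphere k \<and> (\<forall>x\<in>C. \<forall>y\<in>C. \<forall>E. geodesic_arc k x y E \<longrightarrow> E \<subseteq> C)"

end

theory Submission
  imports Defs
begin

text \<open>
  Since \<open>arccos\<close> is antitone, witnesses are described by linear inequalities, and a strong witness
  is a unit vector \<open>w\<close> with \<open>w \<bullet> q \<le> 0\<close> on the convex cone \<open>Q\<close> of all finite combinations
  \<open>\<Sum> c z *\<^sub>R z\<close> of points of \<open>A\<close> with total weight \<open>0\<close> and \<open>c \<ge> 0\<close> off \<open>\<sigma>\<close>. For a given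
  \<open>q \<in> Q\<close>, let \<open>I \<subseteq> \<sigma>\<close> be the set of points with negative weight: then \<open>x\<^sub>I\<close> is nearer to the
  points of negative weight than to the others, so \<open>x\<^sub>I \<bullet> q \<le> 0\<close>. By a theorem of the
  alternative, a single point of the (linear) convex hull of the \<open>x\<^sub>I\<close> works for all of \<open>Q\<close>
  at once, and its radial projection lies in the geodesic convex hull.
\<close>

section \<open>A theorem of the alternative for convex cones\<close>

text \<open>If \<open>convex hull X\<close> misses the polar cone \<open>P\<close> of
  \<open>Q\<close>, a hyperplane with normal \<open>d\<close> separates them. As in the bipolar
  theorem, \<open>- d\<close> lies in \<open>closure Q\<close>, and it has positive inner product
  with every point of \<open>X\<close>; a nearby point of \<open>Q\<close> then violates
  \<open>alt\<close>.\<close>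

lemma convex_cone_alternative:
  fixes X Q :: "'a::euclidean_space set"
  assumes X: "finite X" "X \<noteq> {}"
    and Q: "convex Q" "cone Q" "Q \<noteq> {}"
    and alt: "\<And>q. q \<in> Q \<Longrightarrow> \<exists>x\<in>X. x \<bullet> q \<le> 0"
  shows "\<exists>y \<in> convex hull X. \<forall>q\<in>Q. y \<bullet> q \<le> 0"
proof (rule ccontr)
  define P where "P = {y. \<forall>q\<in>Q. y \<bullet> q \<le> 0}"
  assume "\<not> ?thesis"
  then have disj: "convex hull X \<inter> P = {}" by (auto simp: P_def)
  have Pi: "P = (\<Inter>q\<in>Q. {y. q \<bullet> y \<le> 0})" by (auto simp: P_def inner_commute)
  have P: "convex P" "closed P"
    unfolding Pi by (auto intro!: convex_INT convex_halfspace_le closed_INT closed_halfspace_le)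
  obtain d \<beta> where d: "\<And>y. y \<in> convex hull X \<Longrightarrow> d \<bullet> y < \<beta>" "\<And>y. y \<in> P \<Longrightarrow> d \<bullet> y > \<beta>"
    using separating_hyperplane_compact_closed[of "convex hull X" P] P X disj
    by (metis convex_convex_hull finite_imp_compact_convex_hull convex_hull_eq_empty)
  have "0 \<in> P" by (simp add: P_def)
  from d(2)[OF this] have \<beta>: "\<beta> < 0" by simp
  have dP: "0 \<le> d \<bullet> y" if y: "y \<in> P" for y
  proof (rule ccontr)
    assume neg: "\<not> 0 \<le> d \<bullet> y"
    \<comment> \<open>Rescaling \<open>y\<close> inside the cone \<open>P\<close> makes
      \<open>d\<close> take exactly the value \<beta>, which the strict separation forbids.\<close>
    have "0 \<le> \<beta> / (d \<bullet> y)" using neg \<beta> by (simp add: divide_nonpos_nonpos)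
    then have "(\<beta> / (d \<bullet> y)) *\<^sub>R y \<in> P"
      using y by (simp add: P_def mult_nonneg_nonpos del: times_divide_eq_left)
    from d(2)[OF this] show False using neg by simp
  qed
  have "- d \<in> closure Q"
  proof (rule ccontr)
    assume "- d \<notin> closure Q"
    then obtain y b where y: "y \<bullet> (- d) < b" "\<And>q. q \<in> closure Q \<Longrightarrow> b < y \<bullet> q"
      using separating_hyperplane_closed_point[of "closure Q" "- d"] Q(1)
      by (auto simp: convex_closure)
    have 0: "0 \<in> Q" using Q cone_contains_0 by blast
    then have b: "b < 0" using y(2)[of 0] closure_subset by force
    have "0 \<le> y \<bullet> q" if q: "q \<in> Q" for q
    proof (rule ccontr)
      assume neg: "\<not> 0 \<le> y \<bullet> q"
      have "0 \<le> b / (y \<bullet> q)" using neg b by (simp add: divide_nonpos_nonpos)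
      then have "(b / (y \<bullet> q)) *\<^sub>R q \<in> Q" using q Q(2) by (simp add: cone_def)
      then have "b < y \<bullet> ((b / (y \<bullet> q)) *\<^sub>R q)" using y(2) closure_subset by blast
      then show False using neg by simp
    qed
    then have "- y \<in> P" by (simp add: P_def)
    from dP[OF this] y(1) b show False by (simp add: inner_commute)
  qed
  \<comment> \<open>\<open>Q\<close> need not be closed. Positivity on the finite set
    \<open>X\<close> is an open condition, so it passes from a point of \<open>closure Q\<close> to
    some point of \<open>Q\<close>.\<close>
  moreover have "open (\<Inter>x\<in>X. {z. x \<bullet> z > 0})"
    using X(1) by (intro open_INT ballI open_halfspace_gt)
  moreover have "- d \<in> (\<Inter>x\<in>X. {z. x \<bullet> z > 0})"
    using d(1)[OF hull_inc] \<beta> by (force simp: inner_commute)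
  ultimately have "(\<Inter>x\<in>X. {z. x \<bullet> z > 0}) \<inter> Q \<noteq> {}"
    using open_Int_closure_eq_empty by blast
  then show False using alt by force
qed

section \<open>The cone of combinations of total weight zero\<close>

text \<open>This is the convex cone generated by 0 and the differences \<open>z - a\<close> with
  \<open>z\<close> in \<open>A\<close> and \<open>a\<close> in both \<open>A\<close> and \<sigma>.
  Weights may vanish on \<open>F\<close>, so the support can be enlarged freely.\<close>

definition weight_cone :: "'a::real_vector set \<Rightarrow> 'a set \<Rightarrow> 'a set" where
  "weight_cone A \<sigma> = {\<Sum>z\<in>F. c z *\<^sub>R z | F c.
     finite F \<and> F \<subseteq> A \<and> (\<forall>z\<in>F - \<sigma>. 0 \<le> c z) \<and> sum c F = 0}"

lemma cone_weight_cone: "cone (weight_cone A \<sigma>)"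
proof -
  have "s *\<^sub>R q \<in> weight_cone A \<sigma>" if s: "0 \<le> s" and q: "q \<in> weight_cone A \<sigma>" for s q
  proof -
    obtain F c where "q = (\<Sum>z\<in>F. c z *\<^sub>R z)" "finite F" "F \<subseteq> A" "\<forall>z\<in>F - \<sigma>. 0 \<le> c z"
      "sum c F = 0"
      using q by (auto simp: weight_cone_def)
    then show ?thesis
      using s unfolding weight_cone_def
      by (intro CollectI exI[of _ F] exI[of _ "\<lambda>z. s * c z"])
        (auto simp: scaleR_sum_right sum_distrib_left[symmetric])
  qed
  then show ?thesis by (simp add: cone_def)
qed

lemma add_weight_cone:
  assumes "q \<in> weight_cone A \<sigma>" "q' \<in> weight_cone A \<sigma>"
  shows "q + q' \<in> weight_cone A \<sigma>"
proof -
  obtain F c where q: "q = (\<Sum>z\<in>F. c z *\<^sub>R z)" "finite F" "F \<subseteq> A" "\<forall>z\<in>F - \<sigma>. 0 \<le> c z"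
      "sum c F = 0"
    using assms(1) by (auto simp: weight_cone_def)
  obtain F' c' where q': "q' = (\<Sum>z\<in>F'. c' z *\<^sub>R z)" "finite F'" "F' \<subseteq> A"
      "\<forall>z\<in>F' - \<sigma>. 0 \<le> c' z" "sum c' F' = 0"
    using assms(2) by (auto simp: weight_cone_def)
  \<comment> \<open>Both weight functions are extended by zero to the common support.\<close>
  define e where "e z = (if z \<in> F then c z else 0) + (if z \<in> F' then c' z else 0)" for z
  have ext: "(\<Sum>z\<in>F \<union> F'. if z \<in> F then f z else 0) = sum f F"
      "(\<Sum>z\<in>F \<union> F'. if z \<in> F' then f z else 0) = sum f F'" for f :: "'a \<Rightarrow> 'b::comm_monoid_add"
    using q(2) q'(2) by (simp_all add: sum.inter_restrict[symmetric] Int_absorb1)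
  have "(\<Sum>z\<in>F \<union> F'. e z *\<^sub>R z)
      = (\<Sum>z\<in>F \<union> F'. (if z \<in> F then c z *\<^sub>R z else 0) + (if z \<in> F' then c' z *\<^sub>R z else 0))"
    by (intro sum.cong) (auto simp: e_def scaleR_add_left)
  then have "q + q' = (\<Sum>z\<in>F \<union> F'. e z *\<^sub>R z)"
    using q(1) q'(1) by (simp add: sum.distrib ext)
  moreover have "sum e (F \<union> F') = 0"
    using q(5) q'(5) by (simp add: e_def sum.distrib ext)
  moreover have "\<forall>z\<in>F \<union> F' - \<sigma>. 0 \<le> e z"
    using q(4) q'(4) by (auto simp: e_def)
  moreover have "finite (F \<union> F')" "F \<union> F' \<subseteq> A"
    using q q' by auto
  ultimately show ?thesis unfolding weight_cone_def by blast
qed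

lemma convex_weight_cone: "convex (weight_cone A \<sigma>)"
  using cone_weight_cone[of A \<sigma>] add_weight_cone[of _ A \<sigma>] by (auto simp: convex_def cone_def)

lemma diff_in_weight_cone:
  assumes "z \<in> A" "a \<in> \<sigma>" "a \<in> A"
  shows "z - a \<in> weight_cone A \<sigma>"
\<comment> \<open>The weights 1 and -1 need two distinct points; otherwise the empty sum gives the
  zero vector.\<close>
proof (cases "z = a")
  case True
  then show ?thesis unfolding weight_cone_def
    by (intro CollectI exI[of _ "{}"] exI[of _ "\<lambda>z. 0"]) auto
next
  case False
  then show ?thesis unfolding weight_cone_def
    by (intro CollectI exI[of _ "{z, a}"] exI[of _ "\<lambda>x. if x = a then -1 else 1"])
      (use assms in auto)
qed

text \<open>The hypothesis on \<open>x\<close> is the linear form of being a weak witness for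
  \<open>I\<close>. The least value \<open>m\<close> of \<open>x \<bullet> z\<close> on
  \<open>I\<close> then bounds \<open>x \<bullet> z\<close> from above on
  \<open>A - I\<close>.\<close>

lemma weight_cone_negative_face:
  fixes q :: "'a::real_inner"
  assumes q: "q \<in> weight_cone A \<sigma>" and \<sigma>: "\<sigma> \<noteq> {}"
  obtains I where "I \<noteq> {}" "I \<subseteq> \<sigma>"
    "\<And>x. \<forall>a\<in>I. \<forall>b\<in>A - I. x \<bullet> b \<le> x \<bullet> a \<Longrightarrow> x \<bullet> q \<le> 0"
proof -
  obtain F c where F: "q = (\<Sum>z\<in>F. c z *\<^sub>R z)" "finite F" "F \<subseteq> A" "\<forall>z\<in>F - \<sigma>. 0 \<le> c z"
      "sum c F = 0"
    using q by (auto simp: weight_cone_def)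
  define I where "I = {z\<in>F. c z < 0}"
  show ?thesis
  \<comment> \<open>Without negative weights all weights vanish and \<open>q = 0\<close>, so any
    nonempty face serves.\<close>
  proof (cases "I = {}")
    case True
    then have "\<And>z. z \<in> F \<Longrightarrow> 0 \<le> c z" by (auto simp: I_def not_less)
    then have "\<forall>z\<in>F. c z = 0"
      using F(2,5) sum_nonneg_eq_0_iff[of F c] by blast
    then have "q = 0" using F(1) by simp
    then show ?thesis using that[of \<sigma>] \<sigma> by simp
  next
    case False
    have "x \<bullet> q \<le> 0" if x: "\<forall>a\<in>I. \<forall>b\<in>A - I. x \<bullet> b \<le> x \<bullet> a" for x
    proof -
      define m where "m = Min ((\<bullet>) x ` I)"
      have fin: "finite I" using F(2) by (simp add: I_def)
      have lo: "m \<le> x \<bullet> z" if "z \<in> I" for z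
        using that fin by (simp add: m_def)
      have "m \<in> (\<bullet>) x ` I" unfolding m_def using fin False by (intro Min_in) auto
      then have hi: "x \<bullet> z \<le> m" if "z \<in> A - I" for z
        using that x by auto
      \<comment> \<open>Total weight zero allows subtracting \<open>m\<close> from every inner
        product, after which each summand is nonpositive.\<close>
      have "x \<bullet> q = (\<Sum>z\<in>F. c z * (x \<bullet> z)) - m * sum c F"
        using F(5) by (simp add: F(1) inner_sum_right)
      also have "\<dots> = (\<Sum>z\<in>F. c z * (x \<bullet> z - m))"
        by (simp add: sum_distrib_left sum_subtractf algebra_simps)
      also have "\<dots> \<le> 0"
      proof (rule sum_nonpos)
        fix z assume z: "z \<in> F"
        show "c z * (x \<bullet> z - m) \<le> 0"
        proof (cases "z \<in> I")
          case True
          then show ?thesis using lo[of z] by (simp add: I_def mult_nonpos_nonneg)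
        next
          case False
          then show ?thesis using z hi[of z] F(3) by (auto simp: I_def intro!: mult_nonneg_nonpos)
        qed
      qed
      finally show ?thesis .
    qed
    moreover have "I \<subseteq> \<sigma>" using F(4) by (force simp: I_def)
    ultimately show ?thesis using that False by blast
  qed
qed

section \<open>Radial projection and geodesic convexity\<close>

lemma sgn_combination_in_geodesic_arc:
  assumes E: "geodesic_arc k x y E" and x: "x \<in> hemisphere k"
    and st: "0 \<le> s" "0 \<le> t" "0 < s + t"
  shows "sgn (s *\<^sub>R x + t *\<^sub>R y) \<in> E"
proof -
  obtain u \<theta> where u: "norm u = 1" "x \<bullet> u = 0" "0 \<le> \<theta>" "y = cos \<theta> *\<^sub>R x + sin \<theta> *\<^sub>R u"
    "E = (\<lambda>t. cos t *\<^sub>R x + sin t *\<^sub>R u) ` {0..\<theta>}" and EH: "E \<subseteq> hemisphere k"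
    using E by (auto simp: geodesic_arc_def)
  have nx: "norm x = 1" and xk: "0 < x $ k" using x by (auto simp: hemisphere_def)
  have xE: "x \<in> E" using u(3) by (auto simp: u(5) intro!: image_eqI[of _ _ 0])
  have yE: "y \<in> E" using u(3) by (auto simp: u(4,5))
  have ny: "norm y = 1" using yE EH by (auto simp: hemisphere_def)
  have th: "\<theta> < pi"
  proof (rule ccontr)
    assume "\<not> \<theta> < pi"
    \<comment> \<open>At angle \<open>pi\<close> the arc would pass through \<open>- x\<close>,
      outside the hemisphere.\<close>
    then have "cos pi *\<^sub>R x + sin pi *\<^sub>R u \<in> E" by (subst u(5)) (rule imageI, simp)
    then show False using xk EH by (auto simp: hemisphere_def)
  qed
  consider "s = 0" | "t = 0" | "\<theta> = 0" | "0 < s" "0 < t" "0 < \<theta>" using st u(3) by force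
  then show ?thesis
  proof cases
    case 1
    then show ?thesis using st yE ny by (simp add: sgn_div_norm)
  next
    case 2
    then show ?thesis using st xE nx by (simp add: sgn_div_norm)
  next
    case 3
    then have "s *\<^sub>R x + t *\<^sub>R y = (s + t) *\<^sub>R x" by (simp add: u(4) scaleR_add_left)
    then show ?thesis using st xE nx by (simp add: sgn_div_norm)
  next
    case 4
    have s\<theta>: "0 < sin \<theta>" using 4 th by (simp add: sin_gt_zero)
    \<comment> \<open>The arc point \<open>z\<close> at angle \<phi> satisfies \<open>sin \<theta>
      *\<^sub>R z = sin (\<theta> - \<phi>) *\<^sub>R x + sin \<phi> *\<^sub>R y\<close>. The angle
      sought makes these coefficients proportional to \<open>s\<close> and \<open>t\<close>.\<close>
    have "\<exists>\<phi>\<ge>0. \<phi> \<le> \<theta> \<and> s * sin \<phi> - t * sin (\<theta> - \<phi>) = 0"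
      using 4 s\<theta> by (intro IVT') (auto intro!: continuous_intros)
    then obtain \<phi> where \<phi>: "0 \<le> \<phi>" "\<phi> \<le> \<theta>" "t * sin (\<theta> - \<phi>) = s * sin \<phi>" by auto
    define z where "z = cos \<phi> *\<^sub>R x + sin \<phi> *\<^sub>R u"
    have "\<phi> \<noteq> 0" using \<phi>(3) 4 s\<theta> by auto
    then have s\<phi>: "0 < sin \<phi>" using \<phi> th by (simp add: sin_gt_zero)
    have "(t * sin \<theta>) *\<^sub>R z = (t * sin (\<theta> - \<phi>)) *\<^sub>R x + (t * sin \<phi>) *\<^sub>R y"
      by (simp add: z_def u(4) sin_diff algebra_simps)
    also have "\<dots> = sin \<phi> *\<^sub>R (s *\<^sub>R x + t *\<^sub>R y)"
      by (simp add: \<phi>(3) algebra_simps)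
    finally have "sgn ((t * sin \<theta>) *\<^sub>R z) = sgn (sin \<phi> *\<^sub>R (s *\<^sub>R x + t *\<^sub>R y))" by simp
    then have "sgn z = sgn (s *\<^sub>R x + t *\<^sub>R y)"
      using s\<theta> s\<phi> 4 by (simp add: sgn_scaleR)
    moreover have "sgn z = z"
      using norm_great_circle[OF nx u(1,2)] by (simp add: z_def sgn_div_norm)
    moreover have "z \<in> E" using \<phi> by (auto simp: u(5) z_def)
    ultimately show ?thesis by simp
  qed
qed

lemma norm_scaleR_sgn: "(s * norm y) *\<^sub>R sgn y = s *\<^sub>R y"
  for y :: "'a::real_normed_vector"
  by (cases "y = 0") (simp_all add: sgn_div_norm)

text \<open>A segment between two points of the cone over \<open>H\<close> projects radially into
  the arc joining their projections, and that arc stays in \<open>H\<close>.\<close>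

lemma convex_cone_over_geodesically_convex:
  fixes H :: "(real ^ 'm::finite) set"
  assumes dim: "CARD('m) \<ge> 2" and H: "geodesically_convex k H"
  shows "convex {y. sgn y \<in> H}"
proof (rule convexI)
  fix y y' :: "real ^ 'm" and s t :: real
  assume *: "y \<in> {y. sgn y \<in> H}" "y' \<in> {y. sgn y \<in> H}" "0 \<le> s" "0 \<le> t" "s + t = 1"
  have HH: "sgn y \<in> H" "sgn y' \<in> H" "sgn y \<in> hemisphere k" "sgn y' \<in> hemisphere k"
    using * H by (auto simp: geodesically_convex_def)
  then have nz: "y \<noteq> 0" "y' \<noteq> 0" by (auto simp: hemisphere_def)
  obtain E where E: "geodesic_arc k (sgn y) (sgn y') E"
    using ex1_geodesic_arc[OF dim HH(3,4)] by blast
  have "0 < s * norm y + t * norm y'"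
    using nz * by (cases "s = 0") (auto simp: add_pos_nonneg)
  then have "sgn ((s * norm y) *\<^sub>R sgn y + (t * norm y') *\<^sub>R sgn y') \<in> E"
    using * by (intro sgn_combination_in_geodesic_arc[OF E HH(3)]) auto
  moreover have "E \<subseteq> H" using E H HH by (auto simp: geodesically_convex_def)
  ultimately show "s *\<^sub>R y + t *\<^sub>R y' \<in> {y. sgn y \<in> H}"
    using nz by (auto simp: norm_scaleR_sgn)
qed

text \<open>For each geodesically convex \<open>H\<close> containing \<open>X\<close>, the cone over
  \<open>H\<close> is linearly convex and contains \<open>X\<close>, hence also
  \<open>convex hull X\<close>.\<close>

lemma sgn_convex_hull_in_geodesic_hull:
  fixes X :: "(real ^ 'm::finite) set"
  assumes dim: "CARD('m) \<ge> 2" and X: "X \<subseteq> hemisphere k" and y: "y \<in> convex hull X"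
  shows "sgn y \<in> geodesically_convex k hull X"
  unfolding hull_def
proof (rule InterI, clarify)
  fix H assume H: "geodesically_convex k H" "X \<subseteq> H"
  have "X \<subseteq> {y. sgn y \<in> H}"
  proof
    fix x assume "x \<in> X"
    then show "x \<in> {y. sgn y \<in> H}" using X H by (force simp: hemisphere_def sgn_div_norm)
  qed
  then have "convex hull X \<subseteq> {y. sgn y \<in> H}"
    by (intro hull_minimal convex_cone_over_geodesically_convex[OF dim H(1)])
  then show "sgn y \<in> H" using y by auto
qed

section \<open>Witnesses as linear inequalities\<close>

lemma gdist_le_iff:
  assumes "x \<in> hemisphere k" "a \<in> hemisphere k" "b \<in> hemisphere k"
  shows "gdist x a \<le> gdist x b \<longleftrightarrow> x \<bullet> b \<le> x \<bullet> a"
proof -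
  have "\<bar>x \<bullet> a\<bar> \<le> 1" "\<bar>x \<bullet> b\<bar> \<le> 1"
    using Cauchy_Schwarz_ineq2[of x a] Cauchy_Schwarz_ineq2[of x b] assms
    by (auto simp: hemisphere_def)
  then show ?thesis by (simp add: gdist_def arccos_le_mono)
qed

lemma weak_witness_iff_inner:
  assumes "A \<subseteq> hemisphere k" "\<tau> \<subseteq> A"
  shows "weak_witness k A \<tau> x \<longleftrightarrow>
    x \<in> hemisphere k \<and> (\<forall>a\<in>\<tau>. \<forall>b\<in>A - \<tau>. x \<bullet> b \<le> x \<bullet> a)"
  using gdist_le_iff[of x k] assms unfolding weak_witness_def by (meson DiffD1 subsetD)

text \<open>Letting \<open>b\<close> range over \<sigma> as well encodes equidistance: each pair of
  vertices is compared in both orders.\<close>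

lemma strong_witness_iff_inner:
  assumes "A \<subseteq> hemisphere k" "\<sigma> \<subseteq> A"
  shows "strong_witness k A \<sigma> x \<longleftrightarrow> x \<in> hemisphere k \<and> (\<forall>a\<in>\<sigma>. \<forall>b\<in>A. x \<bullet> b \<le> x \<bullet> a)"
proof -
  have "gdist x a = gdist x a' \<longleftrightarrow> x \<bullet> a' \<le> x \<bullet> a \<and> x \<bullet> a \<le> x \<bullet> a'"
    if "x \<in> hemisphere k" "a \<in> \<sigma>" "a' \<in> \<sigma>" for a a'
    using gdist_le_iff[of x k a a'] gdist_le_iff[of x k a' a] that assms by fastforce
  then show ?thesis
    unfolding strong_witness_def weak_witness_iff_inner[OF assms] using assms(2) by blast
qed

lemma strong_witness_imp_weak_witness_face:
  assumes "A \<subseteq> hemisphere k" "\<sigma> \<subseteq> A" "\<tau> \<subseteq> \<sigma>" "strong_witness k A \<sigma> x"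
  shows "weak_witness k A \<tau> x"
proof -
  have "\<tau> \<subseteq> A" using assms by blast
  then show ?thesis
    using assms by (auto simp: strong_witness_iff_inner weak_witness_iff_inner)
qed

section \<open>Existence of a strong witness in the hull\<close>

lemma strong_witness_in_geodesic_hull:
  fixes x :: "(real ^ 'm::finite) set \<Rightarrow> real ^ 'm"
  assumes dim: "CARD('m) \<ge> 2" and A: "A \<subseteq> hemisphere k"
    and \<sigma>: "\<sigma> \<subseteq> A" "finite \<sigma>" "\<sigma> \<noteq> {}"
    and x: "\<And>I. I \<in> subsimplices \<sigma> \<Longrightarrow> weak_witness k A I (x I)"
  shows "\<exists>w \<in> geodesically_convex k hull (x ` subsimplices \<sigma>). strong_witness k A \<sigma> w"
proof -
  let ?X = "x ` subsimplices \<sigma>"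
  have X: "finite ?X" "?X \<noteq> {}" "?X \<subseteq> hemisphere k"
    using \<sigma> x by (auto simp: subsimplices_def weak_witness_def)
  have "\<exists>z\<in>?X. z \<bullet> q \<le> 0" if q: "q \<in> weight_cone A \<sigma>" for q
  proof -
    obtain I where I: "I \<noteq> {}" "I \<subseteq> \<sigma>"
      "\<And>x. \<forall>a\<in>I. \<forall>b\<in>A - I. x \<bullet> b \<le> x \<bullet> a \<Longrightarrow> x \<bullet> q \<le> 0"
      using weight_cone_negative_face[OF q \<sigma>(3)] by blast
    have IS: "I \<in> subsimplices \<sigma>" and "I \<subseteq> A"
      using I(1,2) \<sigma>(1) by (auto simp: subsimplices_def)
    then have "x I \<bullet> q \<le> 0"
      using x[OF IS] weak_witness_iff_inner[OF A] by (intro I(3)) blast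
    then show ?thesis using IS by blast
  qed
  moreover have "weight_cone A \<sigma> \<noteq> {}"
    using diff_in_weight_cone[of _ A] \<sigma> by blast
  ultimately obtain y where y: "y \<in> convex hull ?X" "\<And>q. q \<in> weight_cone A \<sigma> \<Longrightarrow> y \<bullet> q \<le> 0"
    using convex_cone_alternative[OF X(1,2) convex_weight_cone cone_weight_cone] by blast
  \<comment> \<open>The hull stays in the open half-space of positive \<open>k\<close>-th
    coordinate, so \<open>y\<close> is nonzero and \<open>sgn y\<close> lies in the
    hemisphere.\<close>
  have "convex hull ?X \<subseteq> {z. axis k 1 \<bullet> z > 0}"
    using X(3) by (intro hull_minimal convex_halfspace_gt) (auto simp: hemisphere_def inner_axis')
  then have yk: "0 < y $ k" using y(1) by (auto simp: inner_axis')
  then have ny: "0 < norm y" by auto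
  then have "sgn y \<in> hemisphere k"
    using yk by (auto simp: hemisphere_def norm_sgn sgn_div_norm)
  \<comment> \<open>Testing \<open>y\<close> on the generator \<open>b - a\<close> gives the
    inequality, and dividing by \<open>norm y\<close> preserves it.\<close>
  moreover have "sgn y \<bullet> b \<le> sgn y \<bullet> a" if "a \<in> \<sigma>" "b \<in> A" for a b
    using y(2)[OF diff_in_weight_cone[of b A a \<sigma>]] that \<sigma>(1) ny
    by (auto simp: sgn_div_norm inner_diff_right divide_right_mono intro!: mult_left_mono)
  ultimately have "strong_witness k A \<sigma> (sgn y)"
    by (simp add: strong_witness_iff_inner[OF A \<sigma>(1)])
  then show ?thesis using sgn_convex_hull_in_geodesic_hull[OF dim X(3) y(1)] by blast
qed

theorem mainTheorem5:
  fixes n p :: nat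
    and k :: "'m::finite"
    and A \<sigma> :: "(real ^ 'm) set"
  assumes "n \<ge> 1"
    and "CARD('m) = n + 1"
    and "A \<subseteq> hemisphere k"
    and "simplex_in A p \<sigma>"
  shows "((\<exists>x. strong_witness k A \<sigma> x) \<longleftrightarrow>
            (\<forall>\<tau>\<in>subsimplices \<sigma>. \<exists>x. weak_witness k A \<tau> x)) \<and>
         (\<forall>x :: (real ^ 'm) set \<Rightarrow> real ^ 'm.
            (\<forall>I\<in>subsimplices \<sigma>. weak_witness k A I (x I)) \<longrightarrow>
            (\<exists>w \<in> geodesically_convex k hull (x ` subsimplices \<sigma>). strong_witness k A \<sigma> w))"
proof -
  have dim: "CARD('m) \<ge> 2" using assms by simp
  have \<sigma>: "\<sigma> \<subseteq> A" "finite \<sigma>" "\<sigma> \<noteq> {}" using assms(4) by (auto simp: simplex_in_def)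
  note hull = strong_witness_in_geodesic_hull[OF dim assms(3) \<sigma>]
  have "weak_witness k A \<tau> x" if "strong_witness k A \<sigma> x" "\<tau> \<in> subsimplices \<sigma>" for x \<tau>
    using strong_witness_imp_weak_witness_face[OF assms(3) \<sigma>(1)] that
    by (auto simp: subsimplices_def)
  moreover have "\<exists>x. strong_witness k A \<sigma> x"
    if "\<forall>\<tau>\<in>subsimplices \<sigma>. \<exists>x. weak_witness k A \<tau> x"
  proof -
    \<comment> \<open>Choosing one weak witness per face reduces this direction to the hull
      statement.\<close>
    obtain x where "\<forall>\<tau>\<in>subsimplices \<sigma>. weak_witness k A \<tau> (x \<tau>)"
      using bchoice[OF \<open>\<forall>\<tau>\<in>subsimplices \<sigma>. \<exists>x. weak_witness k A \<tau> x\<close>] by blast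
    then show ?thesis using hull[of x] by blast
  qed
  ultimately show ?thesis using hull by blast
qed

end
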